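(* Let $G$ be a connected $4K_1$-free graph. Then $G$ has a Hamiltonian path if and only if (a) for every articulation point $x$ of $G$, the graph $G-\{x\}$ has exactly 2 connected components, and (b) there are no 3 articulation points of $G$ inducing a triangle in $G$. Moreover, if $G$ does not have a Hamiltonian path, then $G$ has a path cover of size 2 (i.e., $V(G)$ can be covered by two vertex-disjoint paths).
   Context: Graphs are finite, simple and undirected. $4K_1$-free means no independent set of size 4. An articulation point is a vertex $x$ such that $G-\{x\}$ is disconnected. A Hamiltonian path is a path containing all vertices of $G$. *)

theory Defs
  imports "Graph_Theory.Graph_Theory"
begin

(* A finite simple undirected graph is rendered as the locale "graph" of Graph_Theory: a finite,
   loop-free symmetric digraph without parallel arcs, each undirected edge {u, v} being one
   arc from u to v and one from v to u. *)

definition independent_set :: "('a, 'b) pre_digraph \<Rightarrow> 'a set \<Rightarrow> bool" where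
  "independent_set G S \<longleftrightarrow> S \<subseteq> verts G \<and> (\<forall>u\<in>S. \<forall>v\<in>S. \<not> u \<rightarrow>\<^bsub>G\<^esub> v)"

definition four_K1_free :: "('a, 'b) pre_digraph \<Rightarrow> bool" where
  "four_K1_free G \<longleftrightarrow> \<not> (\<exists>S. independent_set G S \<and> card S = 4)"

(* The library's "connected" is false on the null graph. The null graph must not count as
   disconnected either: otherwise the vertex of K1 would be an articulation point. *)
definition disconnected :: "('a, 'b) pre_digraph \<Rightarrow> bool" where
  "disconnected G \<longleftrightarrow> verts G \<noteq> {} \<and> \<not> connected G"

definition articulation_point :: "('a, 'b) pre_digraph \<Rightarrow> 'a \<Rightarrow> bool" where
  "articulation_point G x \<longleftrightarrow> x \<in> verts G \<and> disconnected (pre_digraph.del_vert G x)"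

definition connected_components :: "('a, 'b) pre_digraph \<Rightarrow> ('a, 'b) pre_digraph set" where
  "connected_components G = {H. pre_digraph.max_subgraph G connected H}"

(* A vpath is a nonempty duplicate-free vertex list with consecutive vertices adjacent; a single
   vertex is a path. *)
definition hamiltonian_path :: "('a, 'b) pre_digraph \<Rightarrow> 'a vwalk \<Rightarrow> bool" where
  "hamiltonian_path G p \<longleftrightarrow> vpath p G \<and> set p = verts G"

definition path_cover :: "('a, 'b) pre_digraph \<Rightarrow> 'a vwalk set \<Rightarrow> bool" where
  "path_cover G P \<longleftrightarrow>
    (\<forall>p\<in>P. vpath p G) \<and>
    (\<forall>p\<in>P. \<forall>q\<in>P. p \<noteq> q \<longrightarrow> set p \<inter> set q = {}) \<and>
    (\<Union>p\<in>P. set p) = verts G"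

lemma arc_mono_connected: "arc_mono connected"
  by (auto simp: arc_mono_def)
     (metis spanning_def subgraphE wf_digraph.connected_spanning_imp_connected)

lemma (in wf_digraph) strongly_connected_imp_connected:
  "strongly_connected G \<Longrightarrow> connected G"
  unfolding connected_def strongly_connected_def
  using reachable_mk_symmetricI by (simp add: mk_symmetric_def)

lemma (in sym_digraph) connected_components_eq_sccs:
  "connected_components G = sccs"
proof -
  have A: "strongly_connected H" if H: "induced_subgraph H G" "connected H" for H
    using that sym_arcs
    by (meson induced_graph_imp_symmetric induced_imp_subgraph subgraphE
        wf_digraph.symmetric_connected_imp_strongly_connected)
  have B: "max_subgraph strongly_connected H" if "max_subgraph connected H" for H
  proof -
    have "induced_subgraph H G"
      using that arc_mono_connected by (rule induced_subgraphI_arc_mono)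
    then show ?thesis
      using that A wf_digraph.strongly_connected_imp_connected unfolding max_subgraph_def
      by (metis subgraphE)
  qed
  have C: "max_subgraph connected H" if m: "max_subgraph strongly_connected H" for H
  proof (rule max_subgraphI)
    show H: "subgraph H G" using m by (auto simp: max_subgraph_def)
    then show "connected H"
      using m wf_digraph.strongly_connected_imp_connected unfolding max_subgraph_def
      by (metis subgraphE)
    fix H' assume H': "H \<noteq> H'" "subgraph H H'" "subgraph H' G"
    show "\<not> connected H'"
    proof
      assume S: "connected H'"
      let ?K = "G \<restriction> verts H'"
      have K: "induced_subgraph ?K G" using H' by (auto simp: subgraph_def)
      have sub: "subgraph H' ?K"
        using H' K
        by (auto simp: subgraph_def induced_subgraph_def compatible_def)
          (metis wf_digraph.tail_in_verts wf_digraph.head_in_verts)+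
      then have "spanning H' ?K" by (simp add: spanning_def)
      then have "connected ?K"
        using K S by (meson induced_imp_subgraph subgraphE wf_digraph.connected_spanning_imp_connected)
      then have "strongly_connected ?K" using A K by blast
      moreover have "subgraph H ?K" using H' sub subgraph_trans by blast
      ultimately have "H = ?K"
        using m K unfolding max_subgraph_def by (metis induced_imp_subgraph)
      then have "verts H' = verts H" "arcs H' = arcs H" "tail H' = tail H" "head H' = head H"
        using H' sub by (auto simp: subgraph_def compatible_def)
      then show False using H' by (simp add: pre_digraph.equality)
    qed
  qed
  show ?thesis unfolding connected_components_def sccs_altdef2 using B C by auto
qed

end

theory Submission
  imports Defs
begin

text \<open>
  The main tool is a longest path \<open>p\<close> (possibly with prescribed first vertex) together with a
  connected set \<open>H\<close> avoiding it. As in the Chvatal--Erdos theorem, the successors on \<open>p\<close> of two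
  neighbours of \<open>H\<close>, a vertex of \<open>H\<close>, and, if the first vertex was not prescribed, also the first
  vertex of \<open>p\<close> are pairwise nonadjacent. Without a stable set of size 4, a component outside a
  non-Hamiltonian longest path hence has only one neighbour, which is a cut vertex \<open>x\<close>.

  If \<open>x\<close> separates \<open>A\<close> from \<open>B\<close>, neither side contains a stable triple. A longest path in
  \<open>A \<union> {x}\<close> starting at \<open>x\<close> that misses a component \<open>H\<close> yields a second cut vertex \<open>y\<close> such that
  \<open>H\<close> and the rest \<open>R\<close> of \<open>A\<close> are cliques; then \<open>x\<close>, \<open>R\<close>, \<open>y\<close>, \<open>H\<close> can be traversed in this order
  unless \<open>x\<close> and \<open>y\<close> have the same unique neighbour \<open>c\<close> in \<open>R \<noteq> {c}\<close>, in which case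
  \<open>x\<close>, \<open>y\<close>, \<open>c\<close> form a triangle of cut vertices or \<open>c\<close> leaves three parts. Doing this on both sides
  of \<open>x\<close> gives a Hamiltonian path.

  For the path cover, the ends of a longest path and two nonadjacent vertices outside it would form
  a stable set of size 4, so the vertices outside form a clique.
\<close>

section \<open>Longest paths\<close>

locale fin_adjacency =
  fixes V :: "'a set" and E :: "'a \<Rightarrow> 'a \<Rightarrow> bool"
  assumes finite_V: "finite V"
    and sym: "E u v \<Longrightarrow> E v u"
    and irrefl: "\<not> E u u"
begin

text \<open>Distinctness is built in so that separated sets are disjoint and four pairwise
  \<open>nadj\<close> vertices really form a stable set of size 4.\<close>

definition nadj :: "'a \<Rightarrow> 'a \<Rightarrow> bool" where
  "nadj u v \<longleftrightarrow> u \<noteq> v \<and> \<not> E u v"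

definition separated :: "'a set \<Rightarrow> 'a set \<Rightarrow> bool" where
  "separated A B \<longleftrightarrow> (\<forall>a\<in>A. \<forall>b\<in>B. nadj a b)"

text \<open>Stated by cuts instead of walks, since later arguments ask for an edge leaving a given
  subset. The empty set is excluded, as in the library notion \<open>connected\<close>.\<close>

definition connected_set :: "'a set \<Rightarrow> bool" where
  "connected_set S \<longleftrightarrow> S \<noteq> {} \<and> (\<forall>X\<subseteq>S. X \<noteq> {} \<longrightarrow> separated X (S - X) \<longrightarrow> X = S)"

definition clique :: "'a set \<Rightarrow> bool" where
  "clique S \<longleftrightarrow> (\<forall>u\<in>S. \<forall>v\<in>S. u \<noteq> v \<longrightarrow> E u v)"

definition path_in :: "'a set \<Rightarrow> 'a list \<Rightarrow> bool" where
  "path_in S p \<longleftrightarrow> p \<noteq> [] \<and> distinct p \<and> set p \<subseteq> S \<and> successively E p"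

definition hamiltonian :: "'a list \<Rightarrow> bool" where
  "hamiltonian p \<longleftrightarrow> path_in V p \<and> set p = V"

definition cut_vertex :: "'a \<Rightarrow> bool" where
  "cut_vertex x \<longleftrightarrow> x \<in> V \<and>
     (\<exists>A B. A \<noteq> {} \<and> B \<noteq> {} \<and> separated A B \<and> A \<union> B = V - {x})"

text \<open>The parts may themselves fall apart further, so this expresses that deleting
  \<open>x\<close> leaves at least three components.\<close>

definition splits_into_three :: "'a \<Rightarrow> bool" where
  "splits_into_three x \<longleftrightarrow> x \<in> V \<and>
     (\<exists>A B C. A \<noteq> {} \<and> B \<noteq> {} \<and> C \<noteq> {} \<and>
        separated A B \<and> separated A C \<and> separated B C \<and> A \<union> B \<union> C = V - {x})"

definition stable4_free :: bool where
  "stable4_free \<longleftrightarrow> \<not> (\<exists>a\<in>V. \<exists>b\<in>V. \<exists>c\<in>V. \<exists>d\<in>V.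
     nadj a b \<and> nadj a c \<and> nadj a d \<and> nadj b c \<and> nadj b d \<and> nadj c d)"

definition cut_triangle_free :: bool where
  "cut_triangle_free \<longleftrightarrow> \<not> (\<exists>x y z. cut_vertex x \<and> cut_vertex y \<and> cut_vertex z \<and>
     E x y \<and> E y z \<and> E x z)"

lemma cut_vertexI:
  "\<lbrakk>separated A B; A \<union> B = V - {x}; x \<in> V; A \<noteq> {}; B \<noteq> {}\<rbrakk> \<Longrightarrow> cut_vertex x"
  by (auto simp: cut_vertex_def)

lemma splits_into_threeI:
  "\<lbrakk>separated A B; separated A C; separated B C; A \<union> B \<union> C = V - {x}; x \<in> V;
    A \<noteq> {}; B \<noteq> {}; C \<noteq> {}\<rbrakk> \<Longrightarrow> splits_into_three x"
  unfolding splits_into_three_def by blast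

lemma stable4_freeD:
  "\<lbrakk>stable4_free; a \<in> V; b \<in> V; c \<in> V; d \<in> V; nadj a b; nadj a c; nadj a d;
    nadj b c; nadj b d; nadj c d\<rbrakk> \<Longrightarrow> False"
  unfolding stable4_free_def by blast

lemma nadj_sym: "nadj u v \<Longrightarrow> nadj v u"
  using sym by (auto simp: nadj_def)

lemma separated_sym: "separated A B \<Longrightarrow> separated B A"
  using nadj_sym by (auto simp: separated_def)

lemma separatedD: "separated A B \<Longrightarrow> a \<in> A \<Longrightarrow> b \<in> B \<Longrightarrow> nadj a b"
  by (auto simp: separated_def)

section \<open>Connected sets, components and cliques\<close>

lemma connected_set_edge:
  assumes "connected_set S" "X \<subseteq> S" "X \<noteq> {}" "X \<noteq> S"
  obtains u v where "u \<in> X" "v \<in> S - X" "E u v"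
  using assms unfolding connected_set_def separated_def nadj_def by blast

lemma successively_rev_sym: "successively E (rev p) \<longleftrightarrow> successively E p"
proof -
  have "(\<lambda>x y. E y x) = E" using sym by blast
  then show ?thesis unfolding successively_rev by (rule arg_cong)
qed

lemma path_in_rev: "path_in S (rev p) \<longleftrightarrow> path_in S p"
  by (simp add: path_in_def successively_rev_sym del: successively_rev)

lemma path_in_append:
  assumes "path_in S p" "path_in S q" "set p \<inter> set q = {}" "E (last p) (hd q)"
  shows "path_in S (p @ q)"
  using assms by (auto simp: path_in_def successively_append_iff)

lemma path_in_mono: "path_in S p \<Longrightarrow> S \<subseteq> T \<Longrightarrow> path_in T p"
  by (auto simp: path_in_def)

text \<open>The vertices that a path inside \<open>H\<close> can reach from \<open>a\<close> form a
  nonempty set that no edge of \<open>H\<close> leaves, so by connectedness they exhaust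
  \<open>H\<close>.\<close>

lemma connected_set_path:
  assumes "connected_set H" "a \<in> H" "b \<in> H"
  obtains q where "path_in H q" "hd q = a" "last q = b"
proof -
  define X where "X = {v \<in> H. \<exists>q. path_in H q \<and> hd q = a \<and> last q = v}"
  have "path_in H [a]" using assms by (simp add: path_in_def)
  then have "a \<in> X" using assms unfolding X_def by force
  moreover have "X \<subseteq> H" by (auto simp: X_def)
  moreover have "separated X (H - X)"
  proof (rule ccontr)
    assume "\<not> separated X (H - X)"
    then obtain u v where uv: "u \<in> X" "v \<in> H - X" "E u v"
      by (auto simp: separated_def nadj_def)
    then obtain q where q: "path_in H q" "hd q = a" "last q = u" by (auto simp: X_def)
    show False
    proof (cases "v \<in> set q")
      case True
      then obtain q1 q2 where "q = (q1 @ [v]) @ q2" by (auto dest: split_list)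
      then have "path_in H (q1 @ [v])" "hd (q1 @ [v]) = a"
        using q by (auto simp: path_in_def successively_append_iff hd_append)
      then have "v \<in> X" using uv(2) unfolding X_def by force
      then show False using uv by simp
    next
      case False
      then have "path_in H (q @ [v])"
        using q uv by (intro path_in_append) (auto simp: path_in_def)
      moreover have "hd (q @ [v]) = a" using q by (auto simp: path_in_def)
      ultimately have "v \<in> X" using uv(2) unfolding X_def by force
      then show False using uv by simp
    qed
  qed
  ultimately have "X = H" using assms(1) unfolding connected_set_def by blast
  then show ?thesis using assms(3) that unfolding X_def by blast
qed

text \<open>\<open>H\<close> is the least subset of \<open>S\<close> that contains \<open>v\<close>
  and has no edge to the rest of \<open>S\<close>. A split of \<open>H\<close> would leave the piece
  containing \<open>v\<close> as a smaller such set.\<close>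

lemma ex_component:
  assumes "v \<in> S"
  obtains H where "v \<in> H" "H \<subseteq> S" "connected_set H" "separated H (S - H)"
proof -
  define F where "F = {X. v \<in> X \<and> X \<subseteq> S \<and> separated X (S - X)}"
  define H where "H = \<Inter>F"
  have "S \<in> F" using assms by (simp add: F_def separated_def)
  then have "H \<subseteq> S" by (auto simp: H_def)
  have "v \<in> H" by (auto simp: H_def F_def)
  have sep: "separated H (S - H)"
    by (auto simp: H_def F_def separated_def)
  have "X = H" if X: "X \<subseteq> H" "X \<noteq> {}" "separated X (H - X)" for X
  proof (cases "v \<in> X")
    case True
    have "separated X (S - X)" using X sep unfolding separated_def by blast
    then have "X \<in> F" using True X \<open>H \<subseteq> S\<close> by (auto simp: F_def)
    then show ?thesis using X by (auto simp: H_def)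
  next
    case False
    have "separated (H - X) X" using separated_sym X(3) .
    then have "separated (H - X) (S - (H - X))" using sep unfolding separated_def by blast
    then have "H - X \<in> F" using False \<open>v \<in> H\<close> \<open>H \<subseteq> S\<close> by (auto simp: F_def)
    then have "H \<subseteq> H - X" by (auto simp: H_def)
    then show ?thesis using X by auto
  qed
  then have "connected_set H" using \<open>v \<in> H\<close> unfolding connected_set_def by blast
  then show ?thesis using that \<open>v \<in> H\<close> \<open>H \<subseteq> S\<close> sep by blast
qed

lemma path_within_side:
  assumes "successively E q" "set q \<subseteq> A \<union> B" "separated A B"
  shows "set q \<subseteq> A \<or> set q \<subseteq> B"
  using assms
proof (induction q rule: induct_list012)
  case (3 x y zs)
  have "E x y" "E y x" using 3(3) sym by auto
  then show ?case
    using 3 by (auto simp: separated_def nadj_def)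
qed auto

text \<open>In a clique every enumeration without repetitions is a path, so its ends can be chosen.
  Equal ends are possible only if the clique is a single vertex, whence the last hypothesis.\<close>

lemma clique_path:
  assumes "finite R" "clique R" "a \<in> R" "b \<in> R" "a \<noteq> b \<or> R = {a}"
  obtains q where "path_in R q" "set q = R" "hd q = a" "last q = b"
proof -
  have *: "successively E xs" if "distinct xs" "set xs \<subseteq> R" for xs
    using that assms(2) by (induction xs rule: induct_list012) (auto simp: clique_def)
  obtain xs where xs: "set xs = R - {a, b}" "distinct xs"
    using finite_distinct_list[of "R - {a, b}"] assms(1) by auto
  show ?thesis
  proof (cases "a = b")
    case True
    then show ?thesis using that[of "[a]"] assms by (auto simp: path_in_def)
  next
    case False
    then have "distinct (a # xs @ [b])" "set (a # xs @ [b]) = R" using xs assms by auto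
    then show ?thesis using that[of "a # xs @ [b]"] * by (auto simp: path_in_def)
  qed
qed

lemma clique_path_from:
  assumes "finite R" "clique R" "a \<in> R"
  obtains q where "path_in R q" "set q = R" "hd q = a"
proof (cases "R = {a}")
  case True
  then show ?thesis using that[of "[a]"] by (auto simp: path_in_def)
next
  case False
  then obtain b where "b \<in> R" "b \<noteq> a" using assms by blast
  then show ?thesis using clique_path[of R a b] assms that by blast
qed

section \<open>Longest paths and the successors of their attachment vertices\<close>

text \<open>\<open>P\<close> later fixes the first vertex or is trivially true. A maximum exists
  because a path in \<open>S\<close> has at most \<open>card V\<close> vertices.\<close>

lemma ex_longest_path:
  assumes "S \<subseteq> V" "path_in S p0" "P p0"
  shows "\<exists>p. path_in S p \<and> P p \<and> (\<forall>q. path_in S q \<and> P q \<longrightarrow> length q \<le> length p)"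
proof -
  have "length q \<le> card V" if "path_in S q" for q
  proof -
    have "card (set q) \<le> card V"
      using that assms(1) finite_V by (intro card_mono) (auto simp: path_in_def)
    then show ?thesis using that by (simp add: path_in_def distinct_card)
  qed
  then have "\<exists>p. (path_in S p \<and> P p) \<and> (\<forall>q. path_in S q \<and> P q \<longrightarrow> length q \<le> length p)"
    using assms by (intro ex_has_greatest_nat[of _ p0 _ "Suc (card V)"]) (auto simp: less_Suc_eq_le)
  then show ?thesis by simp
qed

text \<open>These are the successors in the Chvatal-Erdos argument; the explicit decomposition lets
  rotated paths be written down directly.\<close>

definition follows :: "'a list \<Rightarrow> 'a set \<Rightarrow> 'a \<Rightarrow> bool" where
  "follows p H a \<longleftrightarrow> (\<exists>r u t. p = r @ u # a # t \<and> (\<exists>h\<in>H. E u h))"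

lemma follows_in: "follows p H a \<Longrightarrow> distinct p \<Longrightarrow> a \<in> set p - {hd p}"
  by (auto simp: follows_def hd_append split: if_splits)

text \<open>If \<open>u\<close> were last, \<open>h0\<close> could be appended; if its successor had
  a neighbour \<open>h\<close> in \<open>H\<close>, a path through \<open>H\<close> from
  \<open>h0\<close> to \<open>h\<close> could be inserted after \<open>u\<close>. Both extensions
  keep the first vertex, so they compete with \<open>p\<close> for maximality.\<close>

lemma longest_follower:
  assumes p: "path_in S p"
    and longest: "\<And>q. path_in S q \<Longrightarrow> hd q = hd p \<Longrightarrow> length q \<le> length p"
    and H: "connected_set H" "H \<subseteq> S - set p"
    and u: "p = p1 @ u # p2" "h0 \<in> H" "E u h0"
  obtains a t where "p2 = a # t" "\<And>h. h \<in> H \<Longrightarrow> nadj a h"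
proof (cases p2)
  case Nil
  have "path_in S (p @ [h0])"
    using p u H Nil by (auto simp: path_in_def successively_append_iff)
  then show ?thesis using longest[of "p @ [h0]"] p by (auto simp: path_in_def)
next
  case (Cons a t)
  have "nadj a h" if h: "h \<in> H" for h
  proof (rule ccontr)
    assume "\<not> nadj a h"
    then have "E h a" using h u Cons H sym[of a h] by (auto simp: nadj_def)
    obtain q where q: "path_in H q" "hd q = h0" "last q = h"
      using connected_set_path[OF H(1) u(2) h] .
    have "path_in S (p1 @ u # q @ a # t)"
      using p q u H Cons \<open>E h a\<close> by (auto simp: path_in_def successively_append_iff successively_Cons)
    moreover have "hd (p1 @ u # q @ a # t) = hd p" using u by (simp add: hd_append)
    ultimately show False using longest[of "p1 @ u # q @ a # t"] q u Cons by (auto simp: path_in_def)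
  qed
  then show ?thesis using that Cons by blast
qed

text \<open>If the successors \<open>a\<close> of \<open>u\<close> and \<open>b\<close> of
  \<open>v\<close> were adjacent, linking \<open>u\<close> to \<open>v\<close> through
  \<open>H\<close> and reversing the segment from \<open>a\<close> to \<open>v\<close> would give a
  longer path with the same first vertex.\<close>

lemma longest_two_followers:
  assumes p: "path_in S p"
    and longest: "\<And>q. path_in S q \<Longrightarrow> hd q = hd p \<Longrightarrow> length q \<le> length p"
    and H: "connected_set H" "H \<subseteq> S - set p"
    and u: "u \<in> set p" "h \<in> H" "E u h"
    and v: "v \<in> set p" "k \<in> H" "E v k" and "u \<noteq> v"
  obtains a b where "follows p H a" "follows p H b" "nadj a b"
    "\<And>h. h \<in> H \<Longrightarrow> nadj a h" "\<And>h. h \<in> H \<Longrightarrow> nadj b h"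
proof -
  note result = that
  \<comment> \<open>Here \<open>u\<close> comes before \<open>v\<close> on \<open>p\<close>; the
    other order follows by exchanging them.\<close>
  have main: thesis
    if p_eq: "p = p1 @ u # p2" and vp2: "v \<in> set p2" and u: "h \<in> H" "E u h" and v: "k \<in> H" "E v k"
    for u v h k p1 p2
  proof -
    obtain a t where a: "p2 = a # t" "\<And>h. h \<in> H \<Longrightarrow> nadj a h"
      using longest_follower[OF p longest H p_eq u] by metis
    \<comment> \<open>\<open>v\<close> has the neighbour \<open>k\<close> in \<open>H\<close> while
      \<open>a\<close> has none, so \<open>v\<close> lies strictly beyond \<open>a\<close>.\<close>
    have "a \<noteq> v" using a(2) v by (auto simp: nadj_def)
    then obtain t1 t2 where t: "t = t1 @ v # t2" using a vp2 by (auto dest: split_list)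
    have p_eq2: "p = (p1 @ u # a # t1) @ v # t2" using p_eq a t by simp
    obtain b t' where b: "t2 = b # t'" "\<And>h. h \<in> H \<Longrightarrow> nadj b h"
      using longest_follower[OF p longest H p_eq2 v] by metis
    have p_eq3: "p = p1 @ u # a # t1 @ v # b # t'" using p_eq2 b by simp
    have "nadj a b"
    proof (rule ccontr)
      assume "\<not> nadj a b"
      then have "E a b" using p p_eq3 by (auto simp: nadj_def path_in_def)
      obtain q where q: "path_in H q" "hd q = h" "last q = k"
        using connected_set_path[OF H(1) u(1) v(1)] .
      \<comment> \<open>detour through \<open>H\<close> from \<open>u\<close> to \<open>v\<close>, then back along \<open>p\<close> to \<open>a\<close> and on to \<open>b\<close>\<close>
      define w where "w = rev (a # t1 @ [v])"
      have "successively E w"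
        using p p_eq3 unfolding w_def successively_rev_sym
        by (auto simp: path_in_def successively_append_iff successively_Cons hd_append split: if_splits)
      moreover have "last w = a" "hd w = v" "w \<noteq> []" "distinct w" "set w = {a, v} \<union> set t1"
        using p p_eq3 by (auto simp: w_def path_in_def)
      ultimately have "path_in S (p1 @ u # q @ w @ b # t')"
        using p q p_eq3 H \<open>E a b\<close> u sym[OF v(2)]
        by (auto simp: path_in_def successively_append_iff successively_Cons)
      moreover have "hd (p1 @ u # q @ w @ b # t') = hd p" using p_eq3 by (simp add: hd_append)
      ultimately show False
        using longest[of "p1 @ u # q @ w @ b # t'"] q p_eq3 by (auto simp: path_in_def w_def)
    qed
    moreover have "follows p H a" "follows p H b"
      using p_eq p_eq2 a(1) b(1) u v unfolding follows_def by blast+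
    ultimately show ?thesis using result[of a b] a(2) b(2) by simp
  qed
  obtain p1 p2 where p12: "p = p1 @ u # p2" using u by (auto dest: split_list)
  show ?thesis
  proof (cases "v \<in> set p2")
    case True
    then show ?thesis using main[OF p12] u v by blast
  next
    case False
    then obtain r1 r2 where "p1 = r1 @ v # r2" using v \<open>u \<noteq> v\<close> p12 by (auto dest: split_list)
    then show ?thesis using main[of r1 v "r2 @ u # p2" u k h] p12 u v by auto
  qed
qed

text \<open>A neighbour outside could be put in front. This changes the first vertex, so maximality
  among all paths in \<open>S\<close> is assumed.\<close>

lemma longest_path_hd:
  assumes p: "path_in S p" and longest: "\<And>q. path_in S q \<Longrightarrow> length q \<le> length p"
    and "h \<in> S - set p"
  shows "nadj (hd p) h"
proof (rule ccontr)
  assume "\<not> nadj (hd p) h"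
  then have "E h (hd p)" using p assms(3) sym[of "hd p" h] by (auto simp: nadj_def path_in_def)
  then have "path_in S (h # p)" using p assms(3) by (auto simp: path_in_def successively_Cons)
  then show False using longest[of "h # p"] by simp
qed

text \<open>If \<open>hd p\<close> were adjacent to the successor \<open>a\<close> of
  \<open>u\<close>, then \<open>h\<close>, the initial segment up to \<open>u\<close> reversed, and
  the rest of \<open>p\<close> from \<open>a\<close> on would form a longer path.\<close>

lemma longest_path_hd_follower:
  assumes p: "path_in S p" and longest: "\<And>q. path_in S q \<Longrightarrow> length q \<le> length p"
    and H: "H \<subseteq> S - set p" and a: "follows p H a"
  shows "nadj (hd p) a"
proof (rule ccontr)
  assume "\<not> nadj (hd p) a"
  obtain r u t h where r: "p = r @ u # a # t" "h \<in> H" "E u h" using a by (auto simp: follows_def)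
  have "hd p \<noteq> a" using r p by (auto simp: path_in_def hd_append)
  then have E: "E (hd p) a" using \<open>\<not> nadj (hd p) a\<close> by (auto simp: nadj_def)
  define w where "w = rev (r @ [u])"
  have "successively E w"
    using p r unfolding w_def successively_rev_sym
    by (auto simp: path_in_def successively_append_iff successively_Cons)
  moreover have "last w = hd p" "hd w = u" "w \<noteq> []" "distinct w" "set w = insert u (set r)"
    using r p by (auto simp: w_def last_rev hd_append path_in_def)
  ultimately have "path_in S (h # w @ a # t)"
    using p r(1,2) sym[OF r(3)] E H
    by (auto simp: path_in_def successively_append_iff successively_Cons)
  then show False using longest[of "h # w @ a # t"] r by (simp add: w_def)
qed

section \<open>Cut vertices and Hamiltonian paths\<close>

text \<open>A component \<open>H\<close> outside a longest path attaches to it at a single vertex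
  \<open>u\<close>, whose removal cuts \<open>H\<close> off.\<close>

lemma no_hamiltonian_path_imp_cut_vertex:
  assumes "connected_set V" "stable4_free" "\<nexists>p. hamiltonian p"
  obtains x where "cut_vertex x"
proof -
  obtain v0 where v0: "v0 \<in> V" using assms(1) by (auto simp: connected_set_def)
  then have "path_in V [v0]" by (simp add: path_in_def)
  then obtain p where p: "path_in V p" and long: "\<And>q. path_in V q \<Longrightarrow> length q \<le> length p"
    using ex_longest_path[of V "[v0]" "\<lambda>_. True"] by auto
  have pV: "set p \<subseteq> V" using p by (simp add: path_in_def)
  moreover have "set p \<noteq> V" using assms(3) p by (auto simp: hamiltonian_def)
  ultimately obtain v where "v \<in> V - set p" by blast
  then obtain H where H: "v \<in> H" "H \<subseteq> V - set p" "connected_set H" "separated H (V - set p - H)"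
    by (rule ex_component)
  have hp: "hd p \<in> set p" using p by (simp add: path_in_def)
  obtain h u where hu: "h \<in> H" "u \<in> V - H" "E h u"
  proof (rule connected_set_edge[OF assms(1), of H])
    show "H \<subseteq> V" "H \<noteq> {}" "H \<noteq> V" using H(1,2) hp pV by auto
  qed
  have u: "u \<in> set p" using H(4) hu by (auto simp: separated_def nadj_def)
  \<comment> \<open>A second attachment vertex would make two successors, \<open>hd p\<close> and
    \<open>h\<close> a stable set of size 4.\<close>
  have uniq: "u' = u" if u': "u' \<in> set p" "k \<in> H" "E u' k" for u' k
  proof (rule ccontr)
    assume "u' \<noteq> u"
    obtain a b where ab: "follows p H a" "follows p H b" "nadj a b"
      "\<And>h. h \<in> H \<Longrightarrow> nadj a h" "\<And>h. h \<in> H \<Longrightarrow> nadj b h"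
      using longest_two_followers[OF p long H(3,2) u' u hu(1) sym[OF hu(3)] \<open>u' \<noteq> u\<close>] by blast
    have "nadj (hd p) a" "nadj (hd p) b"
      using longest_path_hd_follower[OF p long H(2)] ab by blast+
    moreover have "nadj (hd p) h" using longest_path_hd[OF p long] H hu by blast
    moreover have "a \<in> V" "b \<in> V" "hd p \<in> V" "h \<in> V"
      using ab(1,2) follows_in p hp pV H(2) hu(1) by (auto simp: path_in_def)
    ultimately show False using assms(2) ab hu(1) unfolding stable4_free_def by blast
  qed
  have "cut_vertex u"
    unfolding cut_vertex_def
  proof (intro conjI exI)
    show "u \<in> V" using hu by simp
    show "H \<noteq> {}" "H \<union> (V - {u} - H) = V - {u}" using H u by auto
    \<comment> \<open>Since \<open>u\<close> is adjacent to \<open>h\<close> and \<open>hd p\<close>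
      is not, \<open>hd p\<close> remains on the other side of the cut.\<close>
    have "nadj (hd p) h" using longest_path_hd[OF p long] H hu by blast
    then have "hd p \<noteq> u" using hu sym by (auto simp: nadj_def)
    then show "V - {u} - H \<noteq> {}" using hp pV H by blast
    show "separated H (V - {u} - H)"
      unfolding separated_def
    proof (intro ballI)
      fix k w assume kw: "k \<in> H" "w \<in> V - {u} - H"
      show "nadj k w"
      proof (cases "w \<in> set p")
        case True
        then show ?thesis using uniq[of w k] kw sym[of k w] by (auto simp: nadj_def)
      next
        case False
        then show ?thesis using separatedD[OF H(4)] kw by blast
      qed
    qed
  qed
  then show ?thesis by (rule that)
qed

lemma path_from_cut_vertex:
  assumes conn: "connected_set V" and tri: "cut_triangle_free"
    and no3: "\<And>z. \<not> splits_into_three z"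
    and x: "x \<in> V" and AB: "A \<noteq> {}" "B \<noteq> {}" "separated A B" "A \<union> B = V - {x}"
    and st: "\<forall>a\<in>A. \<forall>b\<in>A. \<forall>c\<in>A. \<not> (nadj a b \<and> nadj a c \<and> nadj b c)"
  obtains p where "path_in V p" "hd p = x" "set p = insert x A"
proof -
  define S where "S = insert x A"
  have SV: "S \<subseteq> V" using x AB by (auto simp: S_def)
  have "path_in S [x]" by (simp add: path_in_def S_def)
  then obtain p where p: "path_in S p" and hp: "hd p = x"
    and long: "\<And>q. path_in S q \<Longrightarrow> hd q = hd p \<Longrightarrow> length q \<le> length p"
    using ex_longest_path[of S "[x]" "\<lambda>q. hd q = x"] SV by auto
  have xp: "x \<in> set p" using p hp by (metis path_in_def hd_in_set)
  have pS: "set p \<subseteq> S" using p by (simp add: path_in_def)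
  show ?thesis
  proof (cases "set p = S")
    case True
    then show ?thesis using that path_in_mono[OF p SV] hp S_def by blast
  next
    case False
    then obtain v where "v \<in> S - set p" using pS by blast
    then obtain H where H: "v \<in> H" "H \<subseteq> S - set p" "connected_set H" "separated H (S - set p - H)"
      by (rule ex_component)
    have HA: "H \<subseteq> A" using H xp S_def by blast
    have disj: "A \<inter> B = {}" "x \<notin> A" "x \<notin> B"
      using AB by (auto simp: separated_def nadj_def)
    obtain h y where hy: "h \<in> H" "y \<in> V - H" "E h y"
    proof (rule connected_set_edge[OF conn, of H])
      show "H \<subseteq> V" "H \<noteq> {}" "H \<noteq> V" using H(1) HA disj x SV S_def by auto
    qed
    have "y \<notin> B" using AB(3) hy HA by (auto simp: separated_def nadj_def)
    then have "y \<in> S" using hy AB S_def by blast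
    then have yp: "y \<in> set p" using H(4) hy by (auto simp: separated_def nadj_def)
    \<comment> \<open>Two successors and \<open>h\<close> would be a stable triple; it lies in
      \<open>A\<close> because a successor is never \<open>hd p\<close>, which is
      \<open>x\<close>.\<close>
    have uniq: "y' = y" if y': "y' \<in> set p" "k \<in> H" "E y' k" for y' k
    proof (rule ccontr)
      assume "y' \<noteq> y"
      obtain a b where ab: "follows p H a" "follows p H b" "nadj a b"
        "\<And>h. h \<in> H \<Longrightarrow> nadj a h" "\<And>h. h \<in> H \<Longrightarrow> nadj b h"
        using longest_two_followers[OF p long H(3,2) y' yp hy(1) sym[OF hy(3)] \<open>y' \<noteq> y\<close>] by blast
      have "a \<in> A" "b \<in> A" using ab(1,2) follows_in p hp pS S_def by (auto simp: path_in_def)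
      then show False using st ab hy(1) HA by blast
    qed
    obtain p1 p2 where p12: "p = p1 @ y # p2" using yp by (auto dest: split_list)
    \<comment> \<open>The successor \<open>c\<close> of \<open>y\<close> shows that \<open>R\<close>
      below is nonempty, and having no neighbour in \<open>H\<close> it can complete stable
      triples.\<close>
    obtain c t where c: "p2 = c # t" "\<And>k. k \<in> H \<Longrightarrow> nadj c k"
      using longest_follower[OF p long H(3,2) p12 hy(1) sym[OF hy(3)]] by metis
    have "follows p H c" using p12 c hy sym unfolding follows_def by blast
    then have cp: "c \<in> set p" "c \<noteq> x" using follows_in p hp by (auto simp: path_in_def)
    have Eyc: "E y c" and "c \<noteq> y"
      using p p12 c by (auto simp: path_in_def successively_append_iff successively_Cons)
    define R where "R = A - H - {y}"
    have cR: "c \<in> R" using cp \<open>c \<noteq> y\<close> pS H S_def R_def by blast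
    \<comment> \<open>Edges from \<open>H\<close> to the path end in \<open>y\<close> by
      \<open>uniq\<close>; edges to vertices off the path stay inside the component
      \<open>H\<close>.\<close>
    have HR: "separated H R"
      unfolding separated_def
    proof (intro ballI)
      fix k w assume kw: "k \<in> H" "w \<in> R"
      show "nadj k w"
      proof (cases "w \<in> set p")
        case True
        then show ?thesis using uniq[of w k] kw sym[of k w] by (auto simp: nadj_def R_def)
      next
        case False
        then show ?thesis using separatedD[OF H(4), of k w] kw by (auto simp: R_def S_def)
      qed
    qed
    have RB: "separated R B" and HB: "separated H B"
      using AB(3) HA by (auto simp: separated_def R_def)
    have "y \<noteq> x"
    proof
      assume "y = x"
      then have "H \<union> R \<union> B = V - {x}" using AB HA disj by (auto simp: R_def)
      with HR HB RB have "splits_into_three x"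
        by (rule splits_into_threeI) (use x cR H(1) AB(2) in auto)
      then show False using no3 by simp
    qed
    then have yA: "y \<in> A" using \<open>y \<in> S\<close> S_def by simp
    have yB: "nadj y w" if "w \<in> B" for w using separatedD[OF AB(3) yA that] .
    have xH: "nadj x k" if "k \<in> H" for k
      using uniq[OF xp that] \<open>y \<noteq> x\<close> HA disj that by (auto simp: nadj_def)
    have V: "V = insert x (insert y (H \<union> R \<union> B))"
      using AB HA yA x by (auto simp: R_def)
    have HyR: "y \<notin> H" "y \<notin> R" "x \<notin> H" "x \<notin> R" "y \<notin> B" "H \<inter> R = {}" "R \<inter> B = {}" "H \<inter> B = {}"
      using hy HA yA disj by (auto simp: R_def)
    \<comment> \<open>A nonadjacent pair in \<open>H\<close> together with \<open>c\<close>, or in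
      \<open>R\<close> together with \<open>h\<close>, would be a stable triple of
      \<open>A\<close>.\<close>
    have clH: "clique H"
      unfolding clique_def using st c(2) cR HA R_def unfolding nadj_def by blast
    have clR: "clique R"
      unfolding clique_def using st separatedD[OF HR hy(1)] hy(1) HA R_def unfolding nadj_def by blast
    have cutx: "cut_vertex x" using AB(3,4) x AB(1,2) by (rule cut_vertexI)
    have "separated H (insert x (R \<union> B))"
      using HR HB xH nadj_sym by (auto simp: separated_def)
    moreover have "H \<union> insert x (R \<union> B) = V - {y}" using V HyR \<open>y \<noteq> x\<close> by auto
    ultimately have cuty: "cut_vertex y" by (rule cut_vertexI) (use V H(1) in auto)
    have ex: "\<exists>r\<in>R. E x r"
    proof (rule ccontr)
      assume "\<not> (\<exists>r\<in>R. E x r)"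
      then have "separated R (insert x B)"
        using RB HyR sym by (auto simp: separated_def nadj_def)
      moreover have "separated H (insert x B)"
        using HB xH nadj_sym by (auto simp: separated_def)
      moreover have "H \<union> R \<union> insert x B = V - {y}" using V HyR \<open>y \<noteq> x\<close> by auto
      moreover note HR
      ultimately have "splits_into_three y"
        using splits_into_threeI[of H R "insert x B" y] V cR H(1) by blast
      then show False using no3 by simp
    qed
    \<comment> \<open>The clique \<open>R\<close> is to be traversed from a neighbour
      \<open>r\<close> of \<open>x\<close> to a neighbour \<open>s\<close> of \<open>y\<close>,
      which must differ unless \<open>R\<close> is a single vertex.\<close>
    have "\<exists>r\<in>R. \<exists>s\<in>R. E x r \<and> E y s \<and> (r \<noteq> s \<or> R = {r})"
    proof (rule ccontr)
      assume *: "\<not> (\<exists>r\<in>R. \<exists>s\<in>R. E x r \<and> E y s \<and> (r \<noteq> s \<or> R = {r}))"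
      \<comment> \<open>As \<open>c\<close> is adjacent to \<open>y\<close>, a neighbour of
        \<open>x\<close> in \<open>R\<close> other than \<open>c\<close> would give a valid pair. So
        \<open>c\<close> is the only one, and then also the only neighbour of \<open>y\<close> in
        \<open>R\<close>.\<close>
      then have xc: "E x c" and xuniq: "\<And>r. r \<in> R \<Longrightarrow> E x r \<Longrightarrow> r = c"
        and yuniq: "\<And>r. r \<in> R \<Longrightarrow> E y r \<Longrightarrow> r = c" and "R \<noteq> {c}"
        using ex cR Eyc by metis+
      \<comment> \<open>\<open>Z\<close> hangs on \<open>c\<close> alone: deleting \<open>c\<close>
        cuts it off from \<open>x\<close>, \<open>y\<close>, \<open>B\<close> and
        \<open>H\<close>.\<close>
      define Z where "Z = R - {c}"
      have Z: "Z \<noteq> {}" "Z \<subseteq> R" "c \<notin> Z" using \<open>R \<noteq> {c}\<close> cR by (auto simp: Z_def)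
      have Zx: "nadj k x" and Zy: "nadj k y" if "k \<in> Z" for k
        using that xuniq[of k] yuniq[of k] sym[of k x] sym[of k y] HyR by (auto simp: Z_def nadj_def)
      have ZB: "separated Z B" and ZH: "separated Z H"
        using RB separated_sym[OF HR] Z by (auto simp: separated_def)
      have VZ: "V - {c} = Z \<union> insert x B \<union> insert y H"
        using V cR HyR cp(2) \<open>c \<noteq> y\<close> Z_def by auto
      have Z1: "separated Z (insert x B)" and Z2: "separated Z (insert y H)"
        using Zx Zy ZB ZH by (auto simp: separated_def)
      then have "separated Z (insert x B \<union> insert y H)" by (auto simp: separated_def)
      then have cutc: "cut_vertex c"
        by (rule cut_vertexI) (use Z(1) VZ cR V in auto)
      show False
      proof (cases "E x y")
        case True
        then show False using tri cutx cuty cutc xc Eyc unfolding cut_triangle_free_def by blast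
      next
        case False
        then have "nadj x y" using \<open>y \<noteq> x\<close> by (auto simp: nadj_def)
        \<comment> \<open>With \<open>x\<close> and \<open>y\<close> nonadjacent, deleting
          \<open>c\<close> also parts \<open>B\<close> with \<open>x\<close> from \<open>H\<close>
          with \<open>y\<close>.\<close>
        then have "separated (insert x B) (insert y H)"
          using xH nadj_sym[OF yB] separated_sym[OF HB] by (simp add: separated_def)
        with Z1 Z2 have "splits_into_three c"
          by (rule splits_into_threeI) (use Z(1) VZ cR V in auto)
        then show False using no3 by simp
      qed
    qed
    then obtain r s where rs: "r \<in> R" "s \<in> R" "E x r" "E y s" "r \<noteq> s \<or> R = {r}" by blast
    have "finite R" "finite H" using finite_V V by (auto intro: finite_subset)
    obtain q where q: "path_in R q" "set q = R" "hd q = r" "last q = s"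
      using clique_path[OF \<open>finite R\<close> clR rs(1,2,5)] .
    obtain g where g: "path_in H g" "set g = H" "hd g = h"
      using clique_path_from[OF \<open>finite H\<close> clH hy(1)] .
    have "path_in V (x # q @ y # g)"
      using q g rs(3) sym[OF rs(4)] sym[OF hy(3)] HyR \<open>y \<noteq> x\<close> V
      by (auto simp: path_in_def successively_append_iff successively_Cons)
    moreover have "set (x # q @ y # g) = insert x A"
      using q g yA HA by (auto simp: R_def)
    ultimately show ?thesis using that[of "x # q @ y # g"] by simp
  qed
qed

text \<open>Both sides of a cut vertex \<open>x\<close> are traversed from \<open>x\<close>, and the
  two paths are glued there.\<close>

lemma ex_hamiltonian_path:
  assumes conn: "connected_set V" and free: "stable4_free" and tri: "cut_triangle_free"
    and no3: "\<And>z. \<not> splits_into_three z"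
  shows "\<exists>p. hamiltonian p"
proof (rule ccontr)
  assume noham: "\<nexists>p. hamiltonian p"
  obtain x where "cut_vertex x"
    using no_hamiltonian_path_imp_cut_vertex[OF conn free noham] .
  then obtain A B where x: "x \<in> V" and AB: "A \<noteq> {}" "B \<noteq> {}" "separated A B" "A \<union> B = V - {x}"
    unfolding cut_vertex_def by blast
  have BA: "separated B A" "B \<union> A = V - {x}" using AB separated_sym by auto
  obtain a0 b0 where ab0: "a0 \<in> A" "b0 \<in> B" using AB by blast
  have "A \<subseteq> V" "B \<subseteq> V" using AB by auto
  \<comment> \<open>A stable triple on one side and any vertex of the other side would form a stable
    set of size 4.\<close>
  have no_triple: "\<forall>a\<in>X. \<forall>b\<in>X. \<forall>c\<in>X. \<not> (nadj a b \<and> nadj a c \<and> nadj b c)"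
    if "separated X Y" "X \<subseteq> V" "d \<in> Y" "Y \<subseteq> V" for X Y d
  proof (intro ballI notI)
    fix a b c assume abc: "a \<in> X" "b \<in> X" "c \<in> X" "nadj a b \<and> nadj a c \<and> nadj b c"
    then have "nadj a d" "nadj b d" "nadj c d" using that by (auto simp: separated_def)
    moreover have "a \<in> V" "b \<in> V" "c \<in> V" "d \<in> V" using abc that by auto
    ultimately show False using stable4_freeD[OF free, of a b c d] abc(4) by simp
  qed
  note stA = no_triple[OF AB(3) \<open>A \<subseteq> V\<close> ab0(2) \<open>B \<subseteq> V\<close>]
    and stB = no_triple[OF BA(1) \<open>B \<subseteq> V\<close> ab0(1) \<open>A \<subseteq> V\<close>]
  obtain p where p: "path_in V p" "hd p = x" "set p = insert x A"
    using path_from_cut_vertex[OF conn tri no3 x AB stA] .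
  obtain q where q: "path_in V q" "hd q = x" "set q = insert x B"
    using path_from_cut_vertex[OF conn tri no3 x AB(2,1) BA stB] .
  \<comment> \<open>\<open>x\<close> begins both paths; it is dropped from \<open>p\<close>, and the
    reversal of \<open>q\<close> ends in it.\<close>
  obtain p' where p': "p = x # p'" using p by (cases p) (auto simp: path_in_def)
  have "last (rev q) = x" using q by (simp add: path_in_def last_rev)
  have "A \<inter> B = {}" "x \<notin> A" using AB(3,4) by (auto simp: separated_def nadj_def)
  have "x \<notin> set p'" using p(1) p' by (simp add: path_in_def)
  then have A: "set p' = A" using p(3) p' \<open>x \<notin> A\<close> by (simp add: insert_ident)
  then have "p' \<noteq> []" using AB(1) by auto
  have "path_in V (rev q)" using q path_in_rev by simp
  moreover have "path_in V p'" "E x (hd p')"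
    using p(1) p' \<open>p' \<noteq> []\<close> by (auto simp: path_in_def successively_Cons)
  ultimately have "path_in V (rev q @ p')"
    using \<open>last (rev q) = x\<close> q(3) A \<open>A \<inter> B = {}\<close> \<open>x \<notin> A\<close> by (intro path_in_append) auto
  moreover have "set (rev q @ p') = V" using q(3) A AB(4) x by auto
  ultimately have "hamiltonian (rev q @ p')" by (simp add: hamiltonian_def)
  then show False using noham by blast
qed

section \<open>Necessity of the two conditions\<close>

text \<open>Deleting \<open>x\<close> breaks the path into at most two pieces, each inside one part,
  so three nonempty parts cannot be covered.\<close>

lemma hamiltonian_imp_not_splits_into_three:
  assumes "hamiltonian p"
  shows "\<not> splits_into_three x"
proof
  assume "splits_into_three x"
  then obtain A B C where x: "x \<in> V" and ne: "A \<noteq> {}" "B \<noteq> {}" "C \<noteq> {}"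
    and sep: "separated A B" "separated A C" "separated B C" and V: "A \<union> B \<union> C = V - {x}"
    unfolding splits_into_three_def by blast
  have p: "set p = V" "successively E p" "distinct p"
    using assms by (auto simp: hamiltonian_def path_in_def)
  then obtain q r where qr: "p = q @ x # r" using x by (metis split_list)
  have part: "set w \<subseteq> A \<or> set w \<subseteq> B \<or> set w \<subseteq> C"
    if "successively E w" "set w \<subseteq> A \<union> B \<union> C" for w
  proof -
    have "separated A (B \<union> C)" using sep by (auto simp: separated_def)
    then have "set w \<subseteq> A \<or> set w \<subseteq> B \<union> C" using path_within_side[of w A "B \<union> C"] that by blast
    then show ?thesis using path_within_side[of w B C] that sep by blast
  qed
  have U: "set q \<union> set r = A \<union> B \<union> C" using p qr V by auto
  have "successively E q" "successively E r"
    using p qr by (auto simp: successively_append_iff successively_Cons)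
  then have "set q \<subseteq> A \<or> set q \<subseteq> B \<or> set q \<subseteq> C" "set r \<subseteq> A \<or> set r \<subseteq> B \<or> set r \<subseteq> C"
    using part U by blast+
  moreover have "A \<inter> B = {}" "A \<inter> C = {}" "B \<inter> C = {}"
    using sep by (auto simp: separated_def nadj_def)
  ultimately show False using U ne by blast
qed

text \<open>Without \<open>y\<close> the path leaves the pieces \<open>q\<close> and
  \<open>r\<close>, and the edge between \<open>x\<close> and \<open>z\<close> keeps them on the
  same side of any split.\<close>

lemma chord_bypasses_cut_vertex:
  assumes "hamiltonian (q @ y # r)" "x \<in> set q" "z \<in> set r" "E x z"
  shows "\<not> cut_vertex y"
proof
  assume "cut_vertex y"
  then obtain A B where AB: "A \<noteq> {}" "B \<noteq> {}" "separated A B" "A \<union> B = V - {y}"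
    unfolding cut_vertex_def by blast
  have U: "set q \<union> set r = A \<union> B"
    using assms(1) AB(4) by (auto simp: hamiltonian_def path_in_def)
  have "successively E q" "successively E r"
    using assms(1) by (auto simp: hamiltonian_def path_in_def successively_append_iff successively_Cons)
  then have "set q \<subseteq> A \<or> set q \<subseteq> B" "set r \<subseteq> A \<or> set r \<subseteq> B"
    using path_within_side[of _ A B] U AB(3) by blast+
  moreover have "A \<inter> B = {}" using AB by (auto simp: separated_def nadj_def)
  ultimately have "x \<in> A \<and> z \<in> B \<or> x \<in> B \<and> z \<in> A" using AB(1,2) U assms(2,3) by blast
  then show False using AB(3) assms(4) sym by (auto simp: separated_def nadj_def)
qed

text \<open>The middle one of the three vertices on the path is bypassed by the edge between the
  other two. The cases run through their possible orders.\<close>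

lemma hamiltonian_imp_cut_triangle_free:
  assumes p: "hamiltonian p"
  shows "cut_triangle_free"
  unfolding cut_triangle_free_def
proof clarify
  fix x y z
  assume cut: "cut_vertex x" "cut_vertex y" "cut_vertex z" and E: "E x y" "E y z" "E x z"
  have E': "E y x" "E z y" "E z x" using E sym by auto
  have "x \<in> set p" "y \<in> set p" "z \<in> set p"
    using cut p by (auto simp: cut_vertex_def hamiltonian_def)
  moreover have "x \<noteq> y" "y \<noteq> z" "x \<noteq> z" using E irrefl by auto
  ultimately obtain q r where qr: "p = q @ x # r" "y \<in> set q \<union> set r" "z \<in> set q \<union> set r"
    by (metis (no_types, lifting) Un_iff split_list set_append set_ConsD)
  note bypass = chord_bypasses_cut_vertex
  consider "y \<in> set q" "z \<in> set q" | "y \<in> set r" "z \<in> set r"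
    | "y \<in> set q" "z \<in> set r" | "y \<in> set r" "z \<in> set q"
    using qr by blast
  then show False
  proof cases
    case 1
    obtain s t where st: "q = s @ y # t" using 1 by (metis split_list)
    show False
    proof (cases "z \<in> set s")
      case True
      then show False using bypass[of s y "t @ x # r" z x] p qr st cut E' by simp
    next
      case False
      then obtain t1 t2 where "t = t1 @ z # t2" using 1 st \<open>y \<noteq> z\<close> by (auto dest: split_list)
      then show False using bypass[of "s @ y # t1" z "t2 @ x # r" y x] p qr st cut E' by simp
    qed
  next
    case 2
    obtain s t where st: "r = s @ y # t" using 2 by (metis split_list)
    show False
    proof (cases "z \<in> set t")
      case True
      then show False using bypass[of "q @ x # s" y t x z] p qr st cut E by simp
    next
      case False
      then obtain t1 t2 where "s = t1 @ z # t2" using 2 st \<open>y \<noteq> z\<close> by (auto dest: split_list)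
      then show False using bypass[of "q @ x # t1" z "t2 @ y # t" x y] p qr st cut E by simp
    qed
  next
    case 3
    then show False using bypass[of q x r y z] p qr cut E by simp
  next
    case 4
    then show False using bypass[of q x r z y] p qr cut E' by simp
  qed
qed

text \<open>The second path traverses the clique outside a longest path \<open>p\<close>. The edge
  from \<open>u\<close> to \<open>k\<close> serves to show that the ends of \<open>p\<close> are
  distinct and nonadjacent.\<close>

lemma two_path_cover:
  assumes conn: "connected_set V" and free: "stable4_free" and noham: "\<nexists>p. hamiltonian p"
  obtains p q where "path_in V p" "path_in V q" "set p \<inter> set q = {}" "set p \<union> set q = V"
proof -
  obtain v0 where v0: "v0 \<in> V" using conn by (auto simp: connected_set_def)
  then have "path_in V [v0]" by (simp add: path_in_def)
  then obtain p where p: "path_in V p" and long: "\<And>q. path_in V q \<Longrightarrow> length q \<le> length p"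
    using ex_longest_path[of V "[v0]" "\<lambda>_. True"] by auto
  have pV: "set p \<subseteq> V" "p \<noteq> []" using p by (auto simp: path_in_def)
  have pnV: "set p \<noteq> V" using noham p by (auto simp: hamiltonian_def)
  then obtain v where v: "v \<in> V - set p" using pV by blast
  obtain u k where uk: "u \<in> set p" "k \<in> V - set p" "E u k"
    using connected_set_edge[OF conn pV(1)] pV(2) pnV by auto
  have hd_out: "nadj (hd p) w" and last_out: "nadj (last p) w" if "w \<in> V - set p" for w
  proof -
    show "nadj (hd p) w" using longest_path_hd[OF p long that] .
    have "path_in V (rev p)" using p path_in_rev by simp
    then show "nadj (last p) w"
      using longest_path_hd[of V "rev p" w] long that by (simp add: hd_rev)
  qed
  obtain p1 p2 where p12: "p = p1 @ u # p2" using uk by (auto dest: split_list)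
  have ends: "nadj (hd p) (last p)"
  proof (rule ccontr)
    assume n: "\<not> nadj (hd p) (last p)"
    show False
    proof (cases "hd p = last p")
      case True
      \<comment> \<open>A path with equal ends is a single vertex, here \<open>u\<close>, whose
        neighbour \<open>k\<close> outside contradicts \<open>hd_out\<close>.\<close>
      then have "u = hd p" using p p12 pV
        by (cases p1; cases p2 rule: rev_cases) (auto simp: path_in_def hd_append split: if_splits)
      then show False using hd_out[OF uk(2)] uk(3) by (simp add: nadj_def)
    next
      case False
      then have "E (last p) (hd p)" using n sym by (auto simp: nadj_def)
      \<comment> \<open>The edge joining the ends closes \<open>p\<close> to a cycle; opening it at
        \<open>u\<close> and starting from \<open>k\<close> gives a longer path.\<close>
      then have "path_in V (k # u # p2 @ p1)"
        using p p12 uk(2) sym[OF uk(3)]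
        by (auto simp: path_in_def successively_append_iff successively_Cons hd_append split: if_splits)
      then show False using long[of "k # u # p2 @ p1"] p12 by simp
    qed
  qed
  have "clique (V - set p)"
    unfolding clique_def
  proof (intro ballI impI, rule ccontr)
    fix a b assume ab: "a \<in> V - set p" "b \<in> V - set p" "a \<noteq> b" "\<not> E a b"
    then have "nadj a b" by (simp add: nadj_def)
    moreover have "hd p \<in> V" "last p \<in> V" using pV by auto
    ultimately show False
      using free ends hd_out[OF ab(1)] hd_out[OF ab(2)] last_out[OF ab(1)] last_out[OF ab(2)] ab
      unfolding stable4_free_def by blast
  qed
  then obtain q where "path_in (V - set p) q" "set q = V - set p"
    using clique_path_from[OF finite_Diff[OF finite_V] _ v] by metis
  then show ?thesis using that[of p q] p pV path_in_mono[of "V - set p" q V] by blast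
qed

end

section \<open>Symmetric digraphs\<close>

lemma vpath_iff_successively:
  "vpath p G \<longleftrightarrow> p \<noteq> [] \<and> distinct p \<and> set p \<subseteq> verts G \<and> successively (dominates G) p"
proof -
  have "set (vwalk_arcs p) \<subseteq> arcs_ends G \<longleftrightarrow> successively (dominates G) p"
    by (induction p rule: vwalk_arcs.induct) auto
  then show ?thesis by (auto simp: vpath_def vwalk_def)
qed

section \<open>Components and splits of symmetric digraphs\<close>

context sym_digraph
begin

lemma connected_iff_strongly_connected: "connected G \<longleftrightarrow> strongly_connected G"
  using symmetric_connected_imp_strongly_connected sym_arcs strongly_connected_imp_connected by blast

lemma reachable_stays:
  assumes "u \<rightarrow>\<^sup>* v" "u \<in> A" "verts G \<subseteq> A \<union> B" "\<forall>a\<in>A. \<forall>b\<in>B. a \<noteq> b \<and> \<not> a \<rightarrow> b"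
  shows "v \<in> A"
  using assms by (induction rule: reachable_induct) (auto dest: adj_in_verts)

lemma adj_scc_of: "\<lbrakk>a \<in> scc_of u; a \<rightarrow> b\<rbrakk> \<Longrightarrow> b \<in> scc_of u"
  by (metis reachable_adjI scc_ofI_reachable' scc_of_eq)

text \<open>If \<open>u\<close> does not reach \<open>v\<close>, the component of \<open>u\<close>
  and its complement form a split; conversely, reachability never leaves \<open>A\<close>.\<close>

lemma not_connected_iff_split:
  assumes "verts G \<noteq> {}"
  shows "\<not> connected G \<longleftrightarrow>
    (\<exists>A B. A \<noteq> {} \<and> B \<noteq> {} \<and> (\<forall>a\<in>A. \<forall>b\<in>B. a \<noteq> b \<and> \<not> a \<rightarrow> b) \<and> A \<union> B = verts G)"
    (is "_ \<longleftrightarrow> ?R")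
proof
  assume "\<not> connected G"
  then obtain u v where uv: "u \<in> verts G" "v \<in> verts G" "\<not> u \<rightarrow>\<^sup>* v"
    using assms by (auto simp: connected_iff_strongly_connected strongly_connected_def)
  show ?R
  proof (intro exI conjI)
    show "scc_of u \<noteq> {}" using uv in_scc_of_self by blast
    show "verts G - scc_of u \<noteq> {}" using uv by (auto simp: scc_of_def)
    show "\<forall>a\<in>scc_of u. \<forall>b\<in>verts G - scc_of u. a \<noteq> b \<and> \<not> a \<rightarrow> b"
      using adj_scc_of by blast
    show "scc_of u \<union> (verts G - scc_of u) = verts G"
      by (auto simp: scc_of_def dest: reachable_in_verts)
  qed
next
  assume ?R
  then obtain A B where AB: "A \<noteq> {}" "B \<noteq> {}"
    "\<forall>a\<in>A. \<forall>b\<in>B. a \<noteq> b \<and> \<not> a \<rightarrow> b" "A \<union> B = verts G" by blast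
  then obtain a b where ab: "a \<in> A" "b \<in> B" by blast
  have "\<not> a \<rightarrow>\<^sup>* b" using reachable_stays[of a b A B] AB ab by blast
  moreover have "a \<in> verts G" "b \<in> verts G" using ab AB(4) by auto
  ultimately show "\<not> connected G"
    unfolding connected_iff_strongly_connected strongly_connected_def by blast
qed

text \<open>A disconnected graph has at least two components, so a count other than 2 means at least
  three. They are counted as classes \<open>scc_of\<close>, since by symmetry components and strong
  components coincide.\<close>

lemma card_components_ne_2_iff_split:
  assumes "finite (verts G)" "verts G \<noteq> {}" "\<not> connected G"
  shows "card (connected_components G) \<noteq> 2 \<longleftrightarrow>
    (\<exists>A B C. A \<noteq> {} \<and> B \<noteq> {} \<and> C \<noteq> {} \<and>
      (\<forall>a\<in>A. \<forall>b\<in>B. a \<noteq> b \<and> \<not> a \<rightarrow> b) \<and> (\<forall>a\<in>A. \<forall>c\<in>C. a \<noteq> c \<and> \<not> a \<rightarrow> c) \<and>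
      (\<forall>b\<in>B. \<forall>c\<in>C. b \<noteq> c \<and> \<not> b \<rightarrow> c) \<and> A \<union> B \<union> C = verts G)"
    (is "_ \<longleftrightarrow> ?R")
proof -
  have card: "card (connected_components G) = card (scc_of ` verts G)"
    using card_sccs_verts sccs_verts_conv_scc_of connected_components_eq_sccs by metis
  show ?thesis
  proof
    assume n2: "card (connected_components G) \<noteq> 2"
    obtain u v where uv: "u \<in> verts G" "v \<in> verts G" "\<not> u \<rightarrow>\<^sup>* v"
      using assms(2,3) by (auto simp: connected_iff_strongly_connected strongly_connected_def)
    then have ne: "scc_of u \<noteq> scc_of v" using in_scc_of_self[of v] by (auto simp: scc_of_def)
    then have "card {scc_of u, scc_of v} = 2" by (simp only: card_2_iff) blast
    \<comment> \<open>There must be a class besides those of \<open>u\<close> and \<open>v\<close>;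
      all the remaining vertices together serve as third part.\<close>
    then have "scc_of ` verts G \<noteq> {scc_of u, scc_of v}" using n2 card by metis
    then obtain w where w: "w \<in> verts G" "scc_of w \<noteq> scc_of u" "scc_of w \<noteq> scc_of v"
      using uv by blast
    show ?R
    proof (intro exI conjI)
      show "scc_of u \<noteq> {}" "scc_of v \<noteq> {}" using uv in_scc_of_self by blast+
      show "verts G - scc_of u - scc_of v \<noteq> {}" using w scc_of_eq by blast
      have "scc_of u \<inter> scc_of v = {}" using ne scc_of_eq by blast
      then show "\<forall>a\<in>scc_of u. \<forall>b\<in>scc_of v. a \<noteq> b \<and> \<not> a \<rightarrow> b" using adj_scc_of by blast
      show "\<forall>a\<in>scc_of u. \<forall>c\<in>verts G - scc_of u - scc_of v. a \<noteq> c \<and> \<not> a \<rightarrow> c"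
        "\<forall>b\<in>scc_of v. \<forall>c\<in>verts G - scc_of u - scc_of v. b \<noteq> c \<and> \<not> b \<rightarrow> c"
        using adj_scc_of by blast+
      show "scc_of u \<union> scc_of v \<union> (verts G - scc_of u - scc_of v) = verts G"
        by (auto simp: scc_of_def dest: reachable_in_verts)
    qed
  next
    assume ?R
    then obtain A B C where ABC: "A \<noteq> {}" "B \<noteq> {}" "C \<noteq> {}"
      "\<forall>a\<in>A. \<forall>b\<in>B. a \<noteq> b \<and> \<not> a \<rightarrow> b" "\<forall>a\<in>A. \<forall>c\<in>C. a \<noteq> c \<and> \<not> a \<rightarrow> c"
      "\<forall>b\<in>B. \<forall>c\<in>C. b \<noteq> c \<and> \<not> b \<rightarrow> c" "A \<union> B \<union> C = verts G" by blast
    then obtain a b c where abc: "a \<in> A" "b \<in> B" "c \<in> C" by blast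
    have cover: "verts G \<subseteq> A \<union> (B \<union> C)" "verts G \<subseteq> B \<union> (A \<union> C)" using ABC(7) by auto
    have sepA: "\<forall>a\<in>A. \<forall>d\<in>B \<union> C. a \<noteq> d \<and> \<not> a \<rightarrow> d" using ABC by blast
    \<comment> \<open>Separation is given in one direction only; symmetry of \<open>G\<close> turns
      it around for walks starting in \<open>B\<close>.\<close>
    have sepB: "\<forall>b\<in>B. \<forall>d\<in>A \<union> C. b \<noteq> d \<and> \<not> b \<rightarrow> d" using ABC graph_symmetric by blast
    have "\<not> a \<rightarrow>\<^sup>* b" "\<not> a \<rightarrow>\<^sup>* c"
      using reachable_stays[OF _ abc(1) cover(1) sepA] sepA abc by blast+
    moreover have "\<not> b \<rightarrow>\<^sup>* c"
      using reachable_stays[OF _ abc(2) cover(2) sepB] sepB abc by blast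
    moreover have V: "a \<in> verts G" "b \<in> verts G" "c \<in> verts G" using abc ABC(7) by auto
    ultimately have "scc_of a \<noteq> scc_of b" "scc_of a \<noteq> scc_of c" "scc_of b \<noteq> scc_of c"
      using in_scc_of_self by (auto simp: scc_of_def)
    then have "card {scc_of a, scc_of b, scc_of c} = 3" by simp
    moreover have "card {scc_of a, scc_of b, scc_of c} \<le> card (scc_of ` verts G)"
      using V assms(1) by (intro card_mono) auto
    ultimately show "card (connected_components G) \<noteq> 2" using card by simp
  qed
qed

end

section \<open>Translation between the library notions and the adjacency relation\<close>

context graph
begin

lemma dominates_del_vert:
  "u \<rightarrow>\<^bsub>del_vert x\<^esub> v \<longleftrightarrow> u \<rightarrow> v \<and> u \<noteq> x \<and> v \<noteq> x"
  by (auto simp: arcs_ends_conv del_vert_simps)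

lemma sym_digraph_del_vert: "sym_digraph (del_vert x)"
proof (rule wf_digraph.sym_digraphI[OF wf_digraph_del_vert])
  show "symmetric (del_vert x)"
    using graph_symmetric dominates_del_vert by (auto simp: symmetric_def intro!: symI)
qed

sublocale adj: fin_adjacency "verts G" "dominates G"
  using graph_symmetric adj_not_same by unfold_locales auto

lemma hamiltonian_path_iff: "hamiltonian_path G p \<longleftrightarrow> adj.hamiltonian p"
  by (auto simp: hamiltonian_path_def adj.hamiltonian_def adj.path_in_def vpath_iff_successively)

lemma connected_imp_connected_set:
  assumes "connected G"
  shows "adj.connected_set (verts G)"
proof -
  have "verts G \<noteq> {}" using assms by (auto simp: connected_iff_strongly_connected strongly_connected_def)
  moreover have "X = verts G"
    if X: "X \<subseteq> verts G" "X \<noteq> {}" "adj.separated X (verts G - X)" for X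
  proof (rule ccontr)
    assume "X \<noteq> verts G"
    then have "verts G - X \<noteq> {}" "X \<union> (verts G - X) = verts G" using X(1) by auto
    then show False
      using assms not_connected_iff_split[OF \<open>verts G \<noteq> {}\<close>] X(2,3)
      unfolding adj.separated_def adj.nadj_def by blast
  qed
  ultimately show ?thesis unfolding adj.connected_set_def by blast
qed

lemma four_K1_free_imp_stable4_free:
  assumes "four_K1_free G"
  shows "adj.stable4_free"
  unfolding adj.stable4_free_def
proof clarify
  fix a b c d
  assume V: "a \<in> verts G" "b \<in> verts G" "c \<in> verts G" "d \<in> verts G"
    and n: "adj.nadj a b" "adj.nadj a c" "adj.nadj a d" "adj.nadj b c" "adj.nadj b d" "adj.nadj c d"
  have "independent_set G {a, b, c, d}"
    using V n n[THEN adj.nadj_sym] adj.irrefl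
    by (auto simp: independent_set_def adj.nadj_def)
  moreover have "card {a, b, c, d} = 4" using n by (auto simp: adj.nadj_def)
  ultimately show False using assms by (auto simp: four_K1_free_def)
qed

lemma articulation_point_iff: "articulation_point G x \<longleftrightarrow> adj.cut_vertex x"
proof -
  interpret D: sym_digraph "del_vert x" by (rule sym_digraph_del_vert)
  show ?thesis
  proof (cases "verts (del_vert x) = {}")
    \<comment> \<open>The split criterion needs a vertex, so the null graph is treated apart: it is
      not \<open>disconnected\<close> and has no nonempty parts.\<close>
    case True
    then show ?thesis
      by (auto simp: articulation_point_def disconnected_def adj.cut_vertex_def verts_del_vert)
  next
    case False
    have "(\<forall>a\<in>A. \<forall>b\<in>B. a \<noteq> b \<and> \<not> a \<rightarrow>\<^bsub>del_vert x\<^esub> b) \<and> A \<union> B = verts (del_vert x) \<longleftrightarrow>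
      adj.separated A B \<and> A \<union> B = verts G - {x}" for A B
      unfolding adj.separated_def adj.nadj_def dominates_del_vert verts_del_vert by blast
    then show ?thesis
      unfolding articulation_point_def disconnected_def adj.cut_vertex_def
      using False D.not_connected_iff_split[OF False] by simp
  qed
qed

lemma card_components_del_vert_iff:
  assumes "articulation_point G x"
  shows "card (connected_components (del_vert x)) = 2 \<longleftrightarrow> \<not> adj.splits_into_three x"
proof -
  interpret D: sym_digraph "del_vert x" by (rule sym_digraph_del_vert)
  have x: "x \<in> verts G" "verts (del_vert x) \<noteq> {}" "\<not> connected (del_vert x)"
    using assms by (auto simp: articulation_point_def disconnected_def)
  have "finite (verts (del_vert x))" by (simp add: verts_del_vert)
  note ne2 = D.card_components_ne_2_iff_split[OF this x(2,3)]
  have "(\<forall>a\<in>A. \<forall>b\<in>B. a \<noteq> b \<and> \<not> a \<rightarrow>\<^bsub>del_vert x\<^esub> b) \<and> (\<forall>a\<in>A. \<forall>c\<in>C. a \<noteq> c \<and> \<not> a \<rightarrow>\<^bsub>del_vert x\<^esub> c) \<and>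
      (\<forall>b\<in>B. \<forall>c\<in>C. b \<noteq> c \<and> \<not> b \<rightarrow>\<^bsub>del_vert x\<^esub> c) \<and> A \<union> B \<union> C = verts (del_vert x) \<longleftrightarrow>
      adj.separated A B \<and> adj.separated A C \<and> adj.separated B C \<and> A \<union> B \<union> C = verts G - {x}" for A B C
    unfolding adj.separated_def adj.nadj_def dominates_del_vert verts_del_vert by blast
  then have "card (connected_components (del_vert x)) \<noteq> 2 \<longleftrightarrow> adj.splits_into_three x"
    using ne2 x(1) unfolding adj.splits_into_three_def by simp
  then show ?thesis by blast
qed

text \<open>Merging two of the parts gives a cut. Hence counting components at articulation points
  alone excludes \<open>splits_into_three\<close> at every vertex.\<close>

lemma splits_into_three_imp_articulation_point:
  assumes "adj.splits_into_three x"
  shows "articulation_point G x"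
proof -
  obtain A B C where ABC: "A \<noteq> {}" "B \<noteq> {}" "C \<noteq> {}" "adj.separated A B" "adj.separated A C"
    "A \<union> B \<union> C = verts G - {x}" "x \<in> verts G"
    using assms by (auto simp: adj.splits_into_three_def)
  have "adj.separated A (B \<union> C)" using ABC by (auto simp: adj.separated_def)
  then have "adj.cut_vertex x" by (rule adj.cut_vertexI) (use ABC in auto)
  then show ?thesis by (simp add: articulation_point_iff)
qed

text \<open>Three mutually adjacent vertices of a graph induce the complete digraph on them, so
  triples of vertices can stand for the sets \<open>T\<close>.\<close>

lemma articulation_triangle_iff:
  "(\<exists>T. T \<subseteq> {x. articulation_point G x} \<and> K\<^bsub>3\<^esub> (G \<restriction> T)) \<longleftrightarrow> \<not> adj.cut_triangle_free"
proof
  assume "\<exists>T. T \<subseteq> {x. articulation_point G x} \<and> K\<^bsub>3\<^esub> (G \<restriction> T)"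
  then obtain T where T: "T \<subseteq> {x. articulation_point G x}" "card T = 3"
    "arcs_ends (G \<restriction> T) = {(u, v). (u, v) \<in> T \<times> T \<and> u \<noteq> v}"
    by (auto simp: complete_digraph_def)
  obtain x y z where xyz: "T = {x, y, z}" "x \<noteq> y" "x \<noteq> z" "y \<noteq> z"
    using T(2) by (auto simp: card_3_iff)
  have "x \<rightarrow>\<^bsub>G \<restriction> T\<^esub> y" "y \<rightarrow>\<^bsub>G \<restriction> T\<^esub> z" "x \<rightarrow>\<^bsub>G \<restriction> T\<^esub> z" using T(3) xyz by auto
  then have "x \<rightarrow> y" "y \<rightarrow> z" "x \<rightarrow> z" by (auto dest: dominates_induce_subgraphD)
  moreover have "adj.cut_vertex x" "adj.cut_vertex y" "adj.cut_vertex z"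
    using T(1) xyz by (auto simp: articulation_point_iff)
  ultimately show "\<not> adj.cut_triangle_free" by (auto simp: adj.cut_triangle_free_def)
next
  assume "\<not> adj.cut_triangle_free"
  then obtain x y z where cut: "adj.cut_vertex x" "adj.cut_vertex y" "adj.cut_vertex z"
    and E: "x \<rightarrow> y" "y \<rightarrow> z" "x \<rightarrow> z"
    by (auto simp: adj.cut_triangle_free_def)
  define T where "T = {x, y, z}"
  have T: "T \<subseteq> verts G" using cut by (auto simp: adj.cut_vertex_def T_def)
  then have ind: "induced_subgraph (G \<restriction> T) G" by (rule induced_induce)
  have "digraph (G \<restriction> T)" using ind by (rule digraphI_induced)
  then have "graph (G \<restriction> T)"
    using induced_graph_imp_symmetric[OF sym_arcs ind] by (rule digraph.graphI)
  moreover have "card T = 3"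
  proof -
    have "x \<noteq> y" "y \<noteq> z" "x \<noteq> z" using E adj_not_same by auto
    then show ?thesis by (simp add: T_def)
  qed
  moreover have "arcs_ends (G \<restriction> T) = {(u, v). (u, v) \<in> T \<times> T \<and> u \<noteq> v}"
  proof -
    have "arcs_ends (G \<restriction> T) = {(u, v). u \<rightarrow> v \<and> u \<in> T \<and> v \<in> T}"
      by (auto simp: arcs_ends_conv)
    also have "\<dots> = {(u, v). (u, v) \<in> T \<times> T \<and> u \<noteq> v}"
      using E E[THEN graph_symmetric] adj_not_same by (auto simp: T_def)
    finally show ?thesis .
  qed
  ultimately have "K\<^bsub>3\<^esub> (G \<restriction> T)" by (simp add: complete_digraph_def)
  moreover have "T \<subseteq> {x. articulation_point G x}"
    using cut by (auto simp: T_def articulation_point_iff)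
  ultimately show "\<exists>T. T \<subseteq> {x. articulation_point G x} \<and> K\<^bsub>3\<^esub> (G \<restriction> T)" by blast
qed

end

theorem theorem11:
  fixes G :: "('a, 'b) pre_digraph"
  assumes "graph G"
    and "connected G"
    and "four_K1_free G"
  shows "((\<exists>p. hamiltonian_path G p) \<longleftrightarrow>
      (\<forall>x. articulation_point G x \<longrightarrow>
        card (connected_components (pre_digraph.del_vert G x)) = 2) \<and>
      \<not> (\<exists>T. T \<subseteq> {x. articulation_point G x} \<and> K\<^bsub>3\<^esub> (G \<restriction> T)))
    \<and> (\<not> (\<exists>p. hamiltonian_path G p) \<longrightarrow> (\<exists>P. path_cover G P \<and> card P = 2))"
proof -
  interpret graph G by (rule assms(1))
  have conn: "adj.connected_set (verts G)" using assms(2) by (rule connected_imp_connected_set)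
  have free: "adj.stable4_free" using assms(3) by (rule four_K1_free_imp_stable4_free)
  have "(\<exists>p. adj.hamiltonian p) \<longleftrightarrow> (\<forall>x. \<not> adj.splits_into_three x) \<and> adj.cut_triangle_free"
    using adj.ex_hamiltonian_path[OF conn free] adj.hamiltonian_imp_not_splits_into_three
      adj.hamiltonian_imp_cut_triangle_free by blast
  moreover have "(\<forall>x. \<not> adj.splits_into_three x) \<longleftrightarrow>
      (\<forall>x. articulation_point G x \<longrightarrow> card (connected_components (del_vert x)) = 2)"
    using card_components_del_vert_iff splits_into_three_imp_articulation_point by blast
  moreover have "\<exists>P. path_cover G P \<and> card P = 2" if noham: "\<nexists>p. adj.hamiltonian p"
  proof -
    obtain p q where pq: "adj.path_in (verts G) p" "adj.path_in (verts G) q"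
      "set p \<inter> set q = {}" "set p \<union> set q = verts G"
      using adj.two_path_cover[OF conn free noham] .
    \<comment> \<open>Disjoint nonempty paths are different, so the cover has exactly two
      members.\<close>
    then have "p \<noteq> q" by (auto simp: adj.path_in_def)
    moreover have "path_cover G {p, q}"
      using pq by (auto simp: path_cover_def adj.path_in_def vpath_iff_successively)
    ultimately show ?thesis by (intro exI[of _ "{p, q}"]) simp
  qed
  ultimately show ?thesis unfolding hamiltonian_path_iff articulation_triangle_iff by blast
qed

end
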